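(* Let $\mathbf u=(u_n)_{n\in\mathbb N}$ be an arithmetic sequence, let $\mathcal I$ be a translation invariant free $P$-ideal of $\mathbb N$ and let $x\in[0,1)$. Then $\bar x\in t^{\mathcal I}_{\mathbf u}(\mathbb T)$ if and only if for every $A\in\mathcal P(\mathbb N)\setminus\mathcal I$ the following conditions hold. (a) If $A$ is $b$-bounded, then: (a1) if $A\subseteq^{\mathcal I}\mathrm{supp}(x)$, then $A\subseteq^{\mathcal I}\mathrm{supp}_b(x)$, $A+1\subseteq^{\mathcal I}\mathrm{supp}(x)$, and there exists $A'\subseteq_{\mathcal I}A$ such that $A'\subseteq\mathrm{supp}_b(x)$ and $\lim_{n\in A'}\frac{c_{n+1}+1}{b_{n+1}}=1$; (a2) if $A\cap\mathrm{supp}(x)\in\mathcal I$, then there exists $B'\subseteq_{\mathcal I}A$ such that $\lim_{n\in B'}\frac{c_{n+1}}{b_{n+1}}=0$. (b) If $A$ is $b$-divergent, then there exists $B\subseteq_{\mathcal I}A$ such that $\lim_{n\in B}\varphi\left(\frac{c_n}{b_n}\right)=0$ in $\mathbb T$.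
   Context: $\mathbb N=\{0,1,2,\dots\}$, $\mathbb N_+=\mathbb N\setminus\{0\}$; $\mathbb T=\mathbb R/\mathbb Z$ with canonical projection $\varphi\colon\mathbb R\to\mathbb T$, and $\bar x=\varphi(x)$. For $A\subseteq\mathbb N$ and $n\in\mathbb Z$, $A+n=\{a+n:a\in A\}$. For an infinite $A\subseteq\mathbb N$, $\lim_{n\in A}$ is the limit as $n\to\infty$ along $A$. An ideal of $\mathbb N$ is a non-empty $\mathcal I\subseteq\mathcal P(\mathbb N)$ closed under finite unions and subsets. It is free if it contains all finite subsets of $\mathbb N$; translation invariant if $(A+n)\cap\mathbb N\in\mathcal I$ for all $A\in\mathcal I$, $n\in\mathbb Z$; a $P$-ideal if for every countable family $\{A_n:n\in\mathbb N\}\subseteq\mathcal I$ there is $U\in\mathcal I$ with $A_n\setminus U$ finite for all $n$. Write $A\subseteq^{\mathcal I}B$ if $A\setminus B\in\mathcal I$, and $A\subseteq_{\mathcal I}B$ if $A\subseteq B$ and $B\setminus A\in\mathcal I$. A sequence $(x_n)$ in $\mathbb T$ $\mathcal I$-converges to $y$ if $\{n\in\mathbb N:x_n\notin U\}\in\mathcal I$ for every neighborhood $U$ of $y$; $t^{\mathcal I}_{\mathbf u}(\mathbb T)=\{y\in\mathbb T: u_ny \ \mathcal I\text{-converges to }0\}$. A sequence $\mathbf u=(u_n)_{n\in\mathbb N}$ of integers is arithmetic if it is strictly increasing, $u_0=1$ and $u_n\mid u_{n+1}$ for all $n\in\mathbb N$; put $b_n=u_n/u_{n-1}$ for $n\in\mathbb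 N_+$. Every $x\in[0,1)$ has a unique representation $x=\sum_{n=1}^\infty\frac{c_n}{u_n}$ with $c_n\in\mathbb N$, $c_n<b_n$ for all $n\in\mathbb N_+$ and $c_n<b_n-1$ for infinitely many $n$. Put $\mathrm{supp}(x)=\{n\in\mathbb N_+:c_n\ne0\}$ and $\mathrm{supp}_b(x)=\{n\in\mathbb N_+:c_n=b_n-1\}$. An infinite $A\subseteq\mathbb N$ is $b$-bounded if $(b_n)_{n\in A}$ is bounded, and $b$-divergent if $(b_n)_{n\in A}$ diverges to infinity (finite sets are regarded as both $b$-bounded and $b$-divergent). The index $n=0$, for which $b_n$ and $c_n$ are not defined, is disregarded in these conditions and in limits. *)

theory Defs
  imports "HOL-Analysis.Analysis"
begin

section \<open>The circle group\<close>

quotient_type circle = real / "\<lambda>x y :: real. x - y \<in> \<int>"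
proof (rule equivpI)
  show "reflp (\<lambda>x y :: real. x - y \<in> \<int>)"
    by (simp add: reflp_def)
  show "symp (\<lambda>x y :: real. x - y \<in> \<int>)"
    unfolding symp_def by (metis Ints_minus minus_diff_eq)
  show "transp (\<lambda>x y :: real. x - y \<in> \<int>)"
  proof (rule transpI)
    fix x y z :: real
    assume "x - y \<in> \<int>" "y - z \<in> \<int>"
    then have "(x - y) + (y - z) \<in> \<int>" by (rule Ints_add)
    then show "x - z \<in> \<int>" by simp
  qed
qed

lift_definition to_circle :: "real \<Rightarrow> circle" is "\<lambda>x. x" .

instantiation circle :: ab_group_add
begin

lift_definition zero_circle :: circle is 0 .

lift_definition plus_circle :: "circle \<Rightarrow> circle \<Rightarrow> circle" is "(+)"
proof -
  fix a b c d :: real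
  assume "a - b \<in> \<int>" "c - d \<in> \<int>"
  then have "(a - b) + (c - d) \<in> \<int>" by (rule Ints_add)
  then show "(a + c) - (b + d) \<in> \<int>" by (simp add: algebra_simps)
qed

lift_definition uminus_circle :: "circle \<Rightarrow> circle" is uminus
  by (metis Ints_minus minus_diff_eq minus_diff_minus)

lift_definition minus_circle :: "circle \<Rightarrow> circle \<Rightarrow> circle" is "(-)"
proof -
  fix a b c d :: real
  assume "a - b \<in> \<int>" "c - d \<in> \<int>"
  then have "(a - b) - (c - d) \<in> \<int>" by (rule Ints_diff)
  then show "(a - c) - (b - d) \<in> \<int>" by (simp add: algebra_simps)
qed

instance
  by standard (transfer; simp add: algebra_simps)+

end

text \<open>The quotient topology of \<open>\<real>/\<int>\<close>.\<close>

instantiation circle :: topological_space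
begin

definition open_circle :: "circle set \<Rightarrow> bool" where
  "open_circle U \<longleftrightarrow> open (to_circle -` U)"

instance
proof
  show "open (UNIV :: circle set)"
    by (simp add: open_circle_def)
next
  fix S T :: "circle set"
  assume "open S" "open T"
  then show "open (S \<inter> T)"
    by (simp add: open_circle_def vimage_Int open_Int)
next
  fix K :: "circle set set"
  assume "\<forall>S\<in>K. open S"
  then show "open (\<Union>K)"
    by (auto simp: open_circle_def vimage_Union)
qed

end

lift_definition circle_mult :: "int \<Rightarrow> circle \<Rightarrow> circle" is "\<lambda>k x. of_int k * x"
  by (metis Ints_mult Ints_of_int right_diff_distrib)

section \<open>Ideals on the natural numbers\<close>

definition set_ideal :: "nat set set \<Rightarrow> bool" where
  "set_ideal I \<longleftrightarrow> I \<noteq> {} \<and> (\<forall>A\<in>I. \<forall>B\<in>I. A \<union> B \<in> I) \<and> (\<forall>A\<in>I. \<forall>B. B \<subseteq> A \<longrightarrow> B \<in> I)"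

definition free_ideal :: "nat set set \<Rightarrow> bool" where
  "free_ideal I \<longleftrightarrow> set_ideal I \<and> (\<forall>F. finite F \<longrightarrow> F \<in> I)"

text \<open>The set \<open>{m. \<exists>a\<in>A. int m = int a + k}\<close> is \<open>(A + k) \<inter> \<nat>\<close>.\<close>

definition translation_invariant :: "nat set set \<Rightarrow> bool" where
  "translation_invariant I \<longleftrightarrow> (\<forall>A\<in>I. \<forall>k :: int. {m :: nat. \<exists>a\<in>A. int m = int a + k} \<in> I)"

definition P_ideal :: "nat set set \<Rightarrow> bool" where
  "P_ideal I \<longleftrightarrow> set_ideal I \<and>
     (\<forall>A :: nat \<Rightarrow> nat set. range A \<subseteq> I \<longrightarrow> (\<exists>U\<in>I. \<forall>n. finite (A n - U)))"

text \<open>\<open>subset_mod I A B\<close> is the relation written with the superscript \<open>I\<close> at the inclusion sign,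
  \<open>subset_upto I A B\<close> the one written with the subscript.\<close>

definition subset_mod :: "nat set set \<Rightarrow> nat set \<Rightarrow> nat set \<Rightarrow> bool" where
  "subset_mod I A B \<longleftrightarrow> A - B \<in> I"

definition subset_upto :: "nat set set \<Rightarrow> nat set \<Rightarrow> nat set \<Rightarrow> bool" where
  "subset_upto I A B \<longleftrightarrow> A \<subseteq> B \<and> B - A \<in> I"

definition ideal_converges ::
    "nat set set \<Rightarrow> (nat \<Rightarrow> 'a :: topological_space) \<Rightarrow> 'a \<Rightarrow> bool" where
  "ideal_converges I s y \<longleftrightarrow>
     (\<forall>N. (\<exists>U. open U \<and> y \<in> U \<and> U \<subseteq> N) \<longrightarrow> {n. s n \<notin> N} \<in> I)"

definition characterized_set :: "nat set set \<Rightarrow> (nat \<Rightarrow> int) \<Rightarrow> circle set" where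
  "characterized_set I u = {y. ideal_converges I (\<lambda>n. circle_mult (u n) y) 0}"

text \<open>The filter of \<open>n \<rightarrow> \<infinity>\<close> with \<open>n \<in> A\<close>; it is trivial (\<open>bot\<close>) if \<open>A\<close> is finite.\<close>

definition along :: "nat set \<Rightarrow> nat filter" where
  "along A = inf sequentially (principal A)"

section \<open>Arithmetic sequences and digits\<close>

definition arithmetic_seq :: "(nat \<Rightarrow> int) \<Rightarrow> bool" where
  "arithmetic_seq u \<longleftrightarrow> strict_mono u \<and> u 0 = 1 \<and> (\<forall>n. u n dvd u (Suc n))"

text \<open>Only the values at \<open>n \<ge> 1\<close> are meaningful; there the division is exact.\<close>

definition ratio :: "(nat \<Rightarrow> int) \<Rightarrow> nat \<Rightarrow> int" where
  "ratio u n = u n div u (n - 1)"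

definition is_expansion :: "(nat \<Rightarrow> int) \<Rightarrow> real \<Rightarrow> (nat \<Rightarrow> nat) \<Rightarrow> bool" where
  "is_expansion u x c \<longleftrightarrow>
     (\<forall>n\<ge>1. int (c n) < ratio u n) \<and>
     infinite {n. n \<ge> 1 \<and> int (c n) < ratio u n - 1} \<and>
     (\<lambda>n. real (c (Suc n)) / real_of_int (u (Suc n))) sums x"

text \<open>The value at \<open>0\<close>, which is not a digit, is set to \<open>0\<close> so that the function is unique;
  see \<open>ex1_expansion\<close> below.\<close>

definition digit :: "(nat \<Rightarrow> int) \<Rightarrow> real \<Rightarrow> nat \<Rightarrow> nat" where
  "digit u x = (THE c. c 0 = 0 \<and> is_expansion u x c)"

definition supp :: "(nat \<Rightarrow> int) \<Rightarrow> real \<Rightarrow> nat set" where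
  "supp u x = {n. n \<ge> 1 \<and> digit u x n \<noteq> 0}"

definition supp_b :: "(nat \<Rightarrow> int) \<Rightarrow> real \<Rightarrow> nat set" where
  "supp_b u x = {n. n \<ge> 1 \<and> int (digit u x n) = ratio u n - 1}"

definition b_bounded :: "(nat \<Rightarrow> int) \<Rightarrow> nat set \<Rightarrow> bool" where
  "b_bounded u A \<longleftrightarrow> bounded ((\<lambda>n. real_of_int (ratio u n)) ` (A - {0}))"

definition b_divergent :: "(nat \<Rightarrow> int) \<Rightarrow> nat set \<Rightarrow> bool" where
  "b_divergent u A \<longleftrightarrow> filterlim (ratio u) at_top (along A)"

lemma arithmetic_seq_facts:
  assumes "arithmetic_seq u"
  shows "u n \<ge> int n + 1" and "u (Suc n) = ratio u (Suc n) * u n"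
    and "ratio u (Suc n) \<ge> 2"
proof -
  show *: "u n \<ge> int n + 1" for n
  proof (induction n)
    case (Suc n)
    have "u n < u (Suc n)"
      using assms by (simp add: arithmetic_seq_def strict_mono_Suc_iff)
    with Suc show ?case by simp
  qed (use assms in \<open>simp add: arithmetic_seq_def\<close>)
  show eq: "u (Suc n) = ratio u (Suc n) * u n"
    using assms by (simp add: arithmetic_seq_def ratio_def)
  have "u n < u (Suc n)"
    using assms by (simp add: arithmetic_seq_def strict_mono_Suc_iff)
  with eq have "1 * u n < ratio u (Suc n) * u n" by simp
  then show "ratio u (Suc n) \<ge> 2"
    using *[of n] by (simp only: mult_less_cancel_right) linarith
qed

lemma arithmetic_seq_inverse_tendsto:
  assumes "arithmetic_seq u"
  shows "(\<lambda>n. 1 / real_of_int (u n)) \<longlonglongrightarrow> 0"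
proof (rule tendsto_sandwich[OF _ _ tendsto_const LIMSEQ_inverse_real_of_nat])
  have "real (Suc n) \<le> real_of_int (u n)" for n
    using arithmetic_seq_facts(1)[OF assms, of n] by linarith
  then show "\<forall>\<^sub>F n in sequentially. 1 / real_of_int (u n) \<le> inverse (real (Suc n))"
    by (intro always_eventually allI) (simp add: inverse_eq_divide frac_le)
  show "\<forall>\<^sub>F n in sequentially. 0 \<le> 1 / real_of_int (u n)"
    using arithmetic_seq_facts(1)[OF assms]
    by (intro always_eventually allI) (smt (verit) of_int_0_le_iff of_nat_0_le_iff zero_le_divide_1_iff)
qed

lemma expansion_tail_sums:
  assumes "arithmetic_seq u"
  shows "(\<lambda>k. (real_of_int (ratio u (Suc (k + n))) - 1) / real_of_int (u (Suc (k + n))))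
           sums (1 / real_of_int (u n))"
proof -
  have "(real_of_int (ratio u (Suc m)) - 1) / real_of_int (u (Suc m))
      = 1 / real_of_int (u m) - 1 / real_of_int (u (Suc m))" for m
  proof -
    have "real_of_int (u m) > 0" "real_of_int (ratio u (Suc m)) > 0"
      using arithmetic_seq_facts(1)[OF assms, of m] arithmetic_seq_facts(3)[OF assms, of m] by linarith+
    moreover have "real_of_int (u (Suc m)) = real_of_int (ratio u (Suc m)) * real_of_int (u m)"
      by (metis arithmetic_seq_facts(2)[OF assms] of_int_mult)
    ultimately show ?thesis by (simp add: field_simps)
  qed
  moreover have "(\<lambda>k. 1 / real_of_int (u (k + n)) - 1 / real_of_int (u (Suc k + n)))
      sums (1 / real_of_int (u (0 + n)) - 0)"
    by (rule telescope_sums'[OF LIMSEQ_ignore_initial_segment[OF arithmetic_seq_inverse_tendsto[OF assms]]])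
  ultimately show ?thesis by simp
qed

lemma expansion_partial_sum:
  assumes u: "arithmetic_seq u" and c: "is_expansion u x c"
  shows "(\<Sum>k<n. real (c (Suc k)) / real_of_int (u (Suc k)))
           = real_of_int \<lfloor>real_of_int (u n) * x\<rfloor> / real_of_int (u n)"
proof -
  let ?f = "\<lambda>k. real (c (Suc k)) / real_of_int (u (Suc k))"
  let ?g = "\<lambda>k. (real_of_int (ratio u (Suc (k + n))) - 1) / real_of_int (u (Suc (k + n)))"
  have upos: "real_of_int (u m) > 0" for m
    using arithmetic_seq_facts(1)[OF u, of m] by linarith
  have "\<exists>m. real_of_int (u n) * (\<Sum>k<n. ?f k) = real_of_int m"
  proof (induction n)
    case (Suc n)
    then obtain m where m: "real_of_int (u n) * (\<Sum>k<n. ?f k) = real_of_int m" by blast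
    have "real_of_int (u (Suc n)) * (\<Sum>k<Suc n. ?f k)
        = real_of_int (ratio u (Suc n)) * (real_of_int (u n) * (\<Sum>k<n. ?f k)) + real (c (Suc n))"
      using less_imp_neq[OF upos[of "Suc n"]]
      by (simp add: distrib_left flip: of_int_mult arithmetic_seq_facts(2)[OF u] mult.assoc)
    also have "\<dots> = real_of_int (ratio u (Suc n) * m + int (c (Suc n)))"
      by (simp add: m)
    finally show ?case by blast
  qed auto
  then obtain m where m: "real_of_int (u n) * (\<Sum>k<n. ?f k) = real_of_int m" by blast
  have f_sums: "(\<lambda>k. ?f (k + n)) sums (x - (\<Sum>k<n. ?f k))"
    using c by (simp add: is_expansion_def sums_iff_shift[symmetric]
        sums_iff_shift[of ?f n "x - (\<Sum>k<n. ?f k)"])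
  have g_sums: "?g sums (1 / real_of_int (u n))"
    by (rule expansion_tail_sums[OF u])
  have le: "?f (k + n) \<le> ?g k" for k
  proof -
    have "int (c (Suc (k + n))) < ratio u (Suc (k + n))"
      using c by (simp add: is_expansion_def)
    then have "real (c (Suc (k + n))) \<le> real_of_int (ratio u (Suc (k + n))) - 1"
      by linarith
    then show ?thesis using upos by (intro divide_right_mono) (auto intro: less_imp_le)
  qed
  have "infinite {n. n \<ge> 1 \<and> int (c n) < ratio u n - 1}"
    using c by (simp add: is_expansion_def)
  then obtain j where j: "j > n" "int (c j) < ratio u j - 1"
    unfolding infinite_nat_iff_unbounded by auto
  define i where "i = j - Suc n"
  have ji: "j = Suc (i + n)" using j by (simp add: i_def)
  have "real (c (Suc (i + n))) < real_of_int (ratio u (Suc (i + n))) - 1"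
    using j(2) unfolding ji by linarith
  then have lt: "?f (i + n) < ?g i" using upos by (intro divide_strict_right_mono) auto
  have "0 \<le> x - (\<Sum>k<n. ?f k)"
    using upos by (intro sums_le[OF _ sums_zero f_sums]) (simp add: less_imp_le)
  moreover have "0 < 1 / real_of_int (u n) - (x - (\<Sum>k<n. ?f k))"
  proof -
    have d: "(\<lambda>k. ?g k - ?f (k + n)) sums (1 / real_of_int (u n) - (x - (\<Sum>k<n. ?f k)))"
      by (rule sums_diff[OF g_sums f_sums])
    have "0 < suminf (\<lambda>k. ?g k - ?f (k + n))"
      by (rule suminf_pos2[OF sums_summable[OF d], of i]) (use le lt in \<open>auto simp: algebra_simps\<close>)
    then show ?thesis using sums_unique[OF d] by simp
  qed
  ultimately have "real_of_int m \<le> real_of_int (u n) * x" "real_of_int (u n) * x < real_of_int m + 1"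
    using upos[of n] unfolding m[symmetric] by (auto simp: field_simps)
  then have "\<lfloor>real_of_int (u n) * x\<rfloor> = m" by linarith
  then show ?thesis using m upos[of n] by (simp add: field_simps)
qed

lemma ex_expansion:
  assumes u: "arithmetic_seq u" and x: "0 \<le> x" "x < 1"
  shows "\<exists>c. c 0 = 0 \<and> is_expansion u x c"
proof -
  have upos: "real_of_int (u m) > 0" for m
    using arithmetic_seq_facts(1)[OF u, of m] by linarith
  have ueq: "real_of_int (u (Suc m)) = real_of_int (ratio u (Suc m)) * real_of_int (u m)" for m
    by (metis arithmetic_seq_facts(2)[OF u] of_int_mult)
  define d where "d = (\<lambda>n. \<lfloor>real_of_int (u n) * x\<rfloor>)"
  define c where "c = (\<lambda>n. if n = 0 then 0 else nat (d n - ratio u n * d (n - 1)))"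
  have d: "real_of_int (d n) \<le> real_of_int (u n) * x" "real_of_int (u n) * x < real_of_int (d n) + 1" for n
    unfolding d_def by linarith+
  have rng: "ratio u (Suc n) * d n \<le> d (Suc n)" "d (Suc n) < ratio u (Suc n) * d n + ratio u (Suc n)" for n
  proof -
    have r: "real_of_int (ratio u (Suc n)) > 0"
      using arithmetic_seq_facts(3)[OF u, of n] by linarith
    have "real_of_int (ratio u (Suc n)) * real_of_int (d n) \<le> real_of_int (u (Suc n)) * x"
      using mult_left_mono[OF d(1)[of n], of "real_of_int (ratio u (Suc n))"] r by (simp add: ueq mult.assoc)
    then show "ratio u (Suc n) * d n \<le> d (Suc n)"
      unfolding d_def[THEN fun_cong, of "Suc n"] by (simp add: le_floor_iff)
    have "real_of_int (u (Suc n)) * x < real_of_int (ratio u (Suc n)) * (real_of_int (d n) + 1)"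
      using mult_strict_left_mono[OF d(2)[of n] r] by (simp add: ueq mult.assoc)
    then show "d (Suc n) < ratio u (Suc n) * d n + ratio u (Suc n)"
      unfolding d_def[THEN fun_cong, of "Suc n"] by (simp add: floor_less_iff distrib_left)
  qed
  have c_eq: "int (c (Suc n)) = d (Suc n) - ratio u (Suc n) * d n" for n
    using rng(1)[of n] by (simp add: c_def)
  let ?f = "\<lambda>k. real (c (Suc k)) / real_of_int (u (Suc k))"
  let ?e = "\<lambda>n. real_of_int (d n) / real_of_int (u n)"
  have f_eq: "?f n = ?e (Suc n) - ?e n" for n
  proof -
    have "real (c (Suc n)) = real_of_int (d (Suc n) - ratio u (Suc n) * d n)"
      by (metis c_eq of_int_of_nat_eq)
    then have "?f n = ?e (Suc n) - real_of_int (ratio u (Suc n)) * real_of_int (d n) / real_of_int (u (Suc n))"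
      by (simp add: diff_divide_distrib)
    also have "real_of_int (ratio u (Suc n)) * real_of_int (d n) / real_of_int (u (Suc n)) = ?e n"
      using upos[of n] arithmetic_seq_facts(3)[OF u, of n] by (simp add: ueq)
    finally show ?thesis .
  qed
  have e_lim: "?e \<longlonglongrightarrow> x"
  proof (rule tendsto_sandwich[of "\<lambda>n. x - 1 / real_of_int (u n)" _ _ "\<lambda>_. x"])
    show "\<forall>\<^sub>F n in sequentially. x - 1 / real_of_int (u n) \<le> ?e n"
    proof (intro always_eventually allI)
      fix n
      show "x - 1 / real_of_int (u n) \<le> ?e n"
        using divide_right_mono[OF less_imp_le[OF d(2)[of n]], of "real_of_int (u n)"] upos[of n]
        by (simp add: add_divide_distrib)
    qed
    show "\<forall>\<^sub>F n in sequentially. ?e n \<le> x"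
      using d(1) upos by (intro always_eventually allI) (simp add: field_simps)
    show "(\<lambda>n. x - 1 / real_of_int (u n)) \<longlonglongrightarrow> x"
      using tendsto_diff[OF tendsto_const arithmetic_seq_inverse_tendsto[OF u]] by simp
  qed simp
  have tail: "(\<lambda>k. ?f (k + n)) sums (x - ?e n)" for n
    using telescope_sums[OF LIMSEQ_ignore_initial_segment[OF e_lim, of n]] by (simp add: f_eq)
  have "d 0 = 0"
    using u x by (simp add: d_def arithmetic_seq_def floor_eq_iff)
  then have "?f sums x" using tail[of 0] by simp
  moreover have bound: "int (c n) < ratio u n" if "n \<ge> 1" for n
    using that rng(2)[of "n - 1"] c_eq[of "n - 1"] by simp
  moreover have "infinite {n. n \<ge> 1 \<and> int (c n) < ratio u n - 1}"
  proof
    assume "finite {n. n \<ge> 1 \<and> int (c n) < ratio u n - 1}"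
    then obtain N where N: "\<And>n. n \<ge> 1 \<Longrightarrow> int (c n) < ratio u n - 1 \<Longrightarrow> n \<le> N"
      unfolding finite_nat_set_iff_bounded_le by blast
    have "int (c (Suc (k + N))) = ratio u (Suc (k + N)) - 1" for k
      using N[of "Suc (k + N)"] bound[of "Suc (k + N)"] by linarith
    then have "real (c (Suc (k + N))) = real_of_int (ratio u (Suc (k + N))) - 1" for k
      by (metis of_int_1 of_int_diff of_int_of_nat_eq)
    then have "(\<lambda>k. ?f (k + N)) sums (1 / real_of_int (u N))"
      using expansion_tail_sums[OF u, of N] by simp
    then have "x - ?e N = 1 / real_of_int (u N)"
      using tail[of N] sums_unique2 by blast
    then show False using d(2)[of N] upos[of N] by (simp add: field_simps)
  qed
  ultimately have "is_expansion u x c" by (simp add: is_expansion_def)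
  then show ?thesis by (intro exI[of _ c]) (simp add: c_def)
qed

lemma ex1_expansion:
  assumes u: "arithmetic_seq u" and x: "0 \<le> x" "x < 1"
  shows "\<exists>!c. c 0 = 0 \<and> is_expansion u x c"
proof (rule ex_ex1I[OF ex_expansion[OF assms]])
  fix c c' :: "nat \<Rightarrow> nat"
  assume c: "c 0 = 0 \<and> is_expansion u x c" and c': "c' 0 = 0 \<and> is_expansion u x c'"
  show "c = c'"
  proof
    fix n
    show "c n = c' n"
    proof (cases n)
      case (Suc m)
      let ?S = "\<lambda>c n. \<Sum>k<n. real (c (Suc k)) / real_of_int (u (Suc k))"
      have "?S c k = ?S c' k" for k
        using expansion_partial_sum[OF u] c c' by metis
      from this[of "Suc m"] this[of m]
      have "real (c (Suc m)) / real_of_int (u (Suc m)) = real (c' (Suc m)) / real_of_int (u (Suc m))"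
        by simp
      moreover have "real_of_int (u (Suc m)) > 0"
        using arithmetic_seq_facts(1)[OF u, of "Suc m"] by linarith
      ultimately show ?thesis using Suc by simp
    qed (use c c' in simp)
  qed
qed

end

theory Submission imports Defs begin

text \<open>
  Let \<open>r\<^sub>n\<close> be the fractional part of \<open>u\<^sub>n\<^sub>-\<^sub>1 x\<close>, so that \<open>r\<^sub>n = (c\<^sub>n + r\<^sub>n\<^sub>+\<^sub>1) / b\<^sub>n\<close>. By translation
  invariance, membership of \<open>x\<close> means that \<open>r\<^sub>n\<close> is \<open>I\<close>-convergent to \<open>0\<close> modulo \<open>1\<close>; the
  \<open>P\<close>-property turns this into convergence outside a single \<open>U \<in> I\<close>, and (a), (b) are read off
  from the recursion. Conversely, if \<open>r\<^sub>n\<close> stays away from the integers on some \<open>A \<notin> I\<close>, the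
  \<open>P\<close>-property shrinks \<open>A\<close> to a set outside \<open>I\<close> which is \<open>b\<close>-bounded or \<open>b\<close>-divergent. In the
  divergent case (b) is contradicted at once. In the bounded case (a) says that the digit
  \<open>c\<^sub>n\<close> is extreme (\<open>0\<close> or \<open>b\<^sub>n - 1\<close>) and hands the same situation to \<open>A + 1\<close>; each such step
  halves the bound on the distance from \<open>r\<^sub>n\<close> to the integers, since \<open>b\<^sub>n \<ge> 2\<close>.
\<close>

section \<open>Distance to the nearest integer\<close>

text \<open>The norm of the circle group, kept on real representatives so that neighbourhoods of 0
  in the quotient become inequalities between reals.\<close>

definition int_dist :: "real \<Rightarrow> real" where
  "int_dist y = \<bar>y - of_int (round y)\<bar>"

lemma int_dist_le: "int_dist y \<le> \<bar>y - of_int m\<bar>"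
  by (simp add: int_dist_def round_diff_minimal)

lemma int_dist_add_le: "int_dist (y + z) \<le> int_dist y + \<bar>z\<bar>"
  using int_dist_le[of "y + z" "round y"] by (simp add: int_dist_def)

lemma int_dist_frac [simp]: "int_dist (frac y) = int_dist y"
proof (rule antisym)
  show "int_dist (frac y) \<le> int_dist y"
    using int_dist_le[of "frac y" "round y - \<lfloor>y\<rfloor>"] by (simp add: int_dist_def frac_def)
  show "int_dist y \<le> int_dist (frac y)"
    using int_dist_le[of y "round (frac y) + \<lfloor>y\<rfloor>"] by (simp add: int_dist_def frac_def algebra_simps)
qed

lemma int_dist_less_iff: "int_dist y < e \<longleftrightarrow> (\<exists>m. \<bar>y - of_int m\<bar> < e)"
  using int_dist_le le_less_trans unfolding int_dist_def by blast

text \<open>As \<open>e \<le> 1\<close>, an integer closer than \<open>e\<close> to a point of [0,1)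
  can only be 0 or 1; these are the two alternatives.\<close>

lemma int_dist_lessD:
  assumes "int_dist y < e" "0 \<le> y" "y < 1" "e \<le> 1"
  shows "y < e \<or> 1 - e < y"
proof -
  obtain m where m: "\<bar>y - of_int m\<bar> < e"
    using assms(1) int_dist_less_iff by blast
  then have "real_of_int m > -1" "real_of_int m < 2"
    using assms by linarith+
  then have "m = 0 \<or> m = 1" by linarith
  with m show ?thesis by auto
qed

lemma to_circle_eq_iff: "to_circle a = to_circle b \<longleftrightarrow> a - b \<in> \<int>"
  by transfer simp

lemma circle_mult_to_circle: "circle_mult k (to_circle y) = to_circle (of_int k * y)"
  by transfer simp

lemma zero_circle_eq: "0 = to_circle 0"
  by transfer simp

text \<open>The preimage of \<open>U\<close> contains an interval around 0; subtracting from
  \<open>y\<close> its nearest integer moves it into that interval without changing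
  \<open>to_circle y\<close>.\<close>

lemma open_circle_zeroD:
  assumes "open U" "(0 :: circle) \<in> U"
  shows "\<exists>e>0. \<forall>y. int_dist y < e \<longrightarrow> to_circle y \<in> U"
proof -
  have "open (to_circle -` U)" "0 \<in> to_circle -` U"
    using assms by (simp_all add: open_circle_def flip: zero_circle_eq)
  then obtain e where e: "e > 0" "\<And>y. \<bar>y\<bar> < e \<Longrightarrow> to_circle y \<in> U"
    unfolding open_dist by (force simp: dist_real_def)
  have "to_circle y \<in> U" if "int_dist y < e" for y
  proof -
    have "to_circle (y - of_int (round y)) \<in> U"
      using e(2) that by (simp add: int_dist_def)
    moreover have "to_circle (y - of_int (round y)) = to_circle y"
      by (simp add: to_circle_eq_iff)
    ultimately show ?thesis by simp
  qed
  with e(1) show ?thesis by blast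
qed

text \<open>Converse half of the neighbourhood base at 0: the preimage of the ball is a union of
  intervals around the integers, hence open.\<close>

lemma circle_ball:
  assumes "e > 0"
  shows "\<exists>V. open V \<and> (0 :: circle) \<in> V \<and> (\<forall>y. to_circle y \<in> V \<longleftrightarrow> int_dist y < e)"
proof -
  define V where "V = to_circle ` {y. int_dist y < e}"
  have mem: "to_circle y \<in> V \<longleftrightarrow> int_dist y < e" for y
  proof
    assume "to_circle y \<in> V"
    then obtain z where z: "int_dist z < e" "y - z \<in> \<int>"
      by (auto simp: V_def to_circle_eq_iff)
    then obtain m k where "\<bar>z - of_int m\<bar> < e" "y - z = of_int k"
      by (auto simp: int_dist_less_iff elim: Ints_cases)
    then have "\<bar>y - of_int (m + k)\<bar> < e" by (simp add: algebra_simps)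
    then show "int_dist y < e" unfolding int_dist_less_iff by blast
  qed (simp add: V_def)
  have "to_circle -` V = (\<Union>m. ball (of_int m) e)"
    by (auto simp: mem int_dist_less_iff dist_real_def abs_minus_commute)
  then have "open (to_circle -` V)" by (simp add: open_UN)
  moreover have "int_dist 0 < e" using assms by (simp add: int_dist_def)
  ultimately show ?thesis
    using mem by (intro exI[of _ V]) (simp add: open_circle_def zero_circle_eq)
qed

lemma tendsto_circle_zero_iff:
  "((\<lambda>n. to_circle (f n)) \<longlongrightarrow> 0) F \<longleftrightarrow> (\<forall>e>0. \<forall>\<^sub>F n in F. int_dist (f n) < e)"
proof (intro iffI allI impI)
  fix e :: real assume *: "((\<lambda>n. to_circle (f n)) \<longlongrightarrow> 0) F" "e > 0"
  obtain V :: "circle set" where V: "open V" "0 \<in> V" "\<And>y. to_circle y \<in> V \<longleftrightarrow> int_dist y < e"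
    using circle_ball[OF \<open>e > 0\<close>] by blast
  show "\<forall>\<^sub>F n in F. int_dist (f n) < e"
    using topological_tendstoD[OF *(1) V(1,2)] by (simp add: V(3))
next
  assume *: "\<forall>e>0. \<forall>\<^sub>F n in F. int_dist (f n) < e"
  show "((\<lambda>n. to_circle (f n)) \<longlongrightarrow> 0) F"
  proof (rule topological_tendstoI)
    fix S :: "circle set" assume "open S" "0 \<in> S"
    then obtain e where "e > 0" "\<And>y. int_dist y < e \<Longrightarrow> to_circle y \<in> S"
      using open_circle_zeroD by blast
    with * show "\<forall>\<^sub>F n in F. to_circle (f n) \<in> S"
      by (metis (mono_tags, lifting) eventually_mono)
  qed
qed

section \<open>Ideals\<close>

lemma set_ideal_subset: "set_ideal I \<Longrightarrow> A \<in> I \<Longrightarrow> B \<subseteq> A \<Longrightarrow> B \<in> I"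
  by (auto simp: set_ideal_def)

lemma set_ideal_Un: "set_ideal I \<Longrightarrow> A \<in> I \<Longrightarrow> B \<in> I \<Longrightarrow> A \<union> B \<in> I"
  by (auto simp: set_ideal_def)

lemma ideal_converges_circle_iff:
  assumes "set_ideal I"
  shows "ideal_converges I (\<lambda>n. to_circle (f n)) 0 \<longleftrightarrow> (\<forall>e>0. {n. e \<le> int_dist (f n)} \<in> I)"
proof (intro iffI allI impI)
  fix e :: real assume *: "ideal_converges I (\<lambda>n. to_circle (f n)) 0" "e > 0"
  obtain V :: "circle set" where "open V" "0 \<in> V" "\<And>y. to_circle y \<in> V \<longleftrightarrow> int_dist y < e"
    using circle_ball[OF \<open>e > 0\<close>] by blast
  then have "{n. \<not> int_dist (f n) < e} \<in> I"
    using *(1) unfolding ideal_converges_def by (metis (no_types, lifting) Collect_cong order_refl)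
  then show "{n. e \<le> int_dist (f n)} \<in> I" by (simp add: not_less)
next
  assume *: "\<forall>e>0. {n. e \<le> int_dist (f n)} \<in> I"
  show "ideal_converges I (\<lambda>n. to_circle (f n)) 0"
    unfolding ideal_converges_def
  proof (intro allI impI, elim exE conjE)
    fix N U :: "circle set" assume U: "open U" "0 \<in> U" "U \<subseteq> N"
    then obtain e where e: "e > 0" "\<And>y. int_dist y < e \<Longrightarrow> to_circle y \<in> U"
      using open_circle_zeroD by blast
    have "{n. to_circle (f n) \<notin> N} \<subseteq> {n. e \<le> int_dist (f n)}"
      using e(2) U(3) by (force simp: not_less[symmetric])
    with * e(1) show "{n. to_circle (f n) \<notin> N} \<in> I"
      using set_ideal_subset[OF assms] by blast
  qed
qed

text \<open>The thresholds \<open>1 / (k + 1)\<close> give countably many sets of the ideal; the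
  P-property absorbs each of them, up to finitely many points, in one \<open>U\<close>, and every
  \<open>e\<close> exceeds some threshold.\<close>

lemma P_ideal_pseudo_limit:
  fixes f :: "nat \<Rightarrow> real"
  assumes "P_ideal I" and "\<And>e. e > 0 \<Longrightarrow> {n. e \<le> f n} \<in> I"
  shows "\<exists>U\<in>I. \<forall>e>0. finite {n. n \<notin> U \<and> e \<le> f n}"
proof -
  have "range (\<lambda>k. {n. inverse (real (Suc k)) \<le> f n}) \<subseteq> I"
    using assms(2) by auto
  then obtain U where U: "U \<in> I" "\<And>k. finite ({n. inverse (real (Suc k)) \<le> f n} - U)"
    using assms(1) unfolding P_ideal_def by meson
  have "finite {n. n \<notin> U \<and> e \<le> f n}" if e: "e > 0" for e
  proof -
    obtain k where "inverse (real (Suc k)) < e" using reals_Archimedean[OF e] by blast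
    then show ?thesis by (intro finite_subset[OF _ U(2)[of k]]) auto
  qed
  with U(1) show ?thesis by blast
qed

text \<open>Turns limits along \<open>A\<close> into finiteness of exceptional sets, which a free
  ideal contains.\<close>

lemma eventually_along: "eventually P (along A) \<longleftrightarrow> finite {n \<in> A. \<not> P n}"
proof -
  have "eventually P (along A) \<longleftrightarrow> (\<forall>\<^sub>F n in cofinite. n \<in> A \<longrightarrow> P n)"
    by (simp add: along_def eventually_inf_principal cofinite_eq_sequentially)
  then show ?thesis by (simp add: eventually_cofinite)
qed

lemma eventually_along_mono:
  "eventually P (along A) \<Longrightarrow> B \<subseteq> A \<Longrightarrow> eventually P (along B)"
  unfolding eventually_along by (erule rev_finite_subset) auto

text \<open>At the meaningless index \<open>0\<close> truncated subtraction makes the ratio \<open>1\<close>, the digit \<open>0\<close> and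
  \<open>rescaled_frac u x 0 = rescaled_frac u x 1\<close>, so the recursion \<open>r_rec\<close> and the digit bound
  \<open>c_less\<close> below hold there as well.\<close>

definition rescaled_frac :: "(nat \<Rightarrow> int) \<Rightarrow> real \<Rightarrow> nat \<Rightarrow> real" where
  "rescaled_frac u x n = frac (real_of_int (u (n - 1)) * x)"

context
  fixes u :: "nat \<Rightarrow> int" and I :: "nat set set" and x :: real
  assumes arith: "arithmetic_seq u"
    and ideal: "set_ideal I" and transl: "translation_invariant I"
    and free: "free_ideal I" and P: "P_ideal I"
    and x: "0 \<le> x" "x < 1"
begin

private abbreviation (input) "b \<equiv> ratio u"
private abbreviation (input) "c \<equiv> digit u x"
private abbreviation (input) "r \<equiv> rescaled_frac u x"

private lemmas r_def = rescaled_frac_def[of u x]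

private lemmas subsetI = set_ideal_subset[OF ideal]
private lemmas unionI = set_ideal_Un[OF ideal]

section \<open>The ideal under small changes and unit shifts\<close>

lemma finiteI: "finite F \<Longrightarrow> F \<in> I"
  using free by (simp add: free_ideal_def)

lemma not_in_mono: "A \<notin> I \<Longrightarrow> A \<subseteq> B \<Longrightarrow> B \<notin> I"
  using subsetI by blast

lemma not_in_Diff: "A \<notin> I \<Longrightarrow> B \<in> I \<Longrightarrow> A - B \<notin> I"
  using unionI[of "A - B" B] subsetI[of "A - B \<union> B" A] by blast

lemma subset_upto_not_in: "subset_upto I B A \<Longrightarrow> A \<notin> I \<Longrightarrow> B \<notin> I"
  using unionI[of B "A - B"] subsetI[of "B \<union> (A - B)" A] by (auto simp: subset_upto_def)

lemma shift_in: "A \<in> I \<Longrightarrow> {n. Suc n \<in> A} \<in> I"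
proof -
  assume "A \<in> I"
  then have "{m. \<exists>a\<in>A. int m = int a + (- 1)} \<in> I"
    using transl unfolding translation_invariant_def by blast
  then show ?thesis by (rule subsetI) force
qed

lemma Suc_image_in_iff: "Suc ` A \<in> I \<longleftrightarrow> A \<in> I"
proof
  assume "Suc ` A \<in> I"
  from shift_in[OF this] show "A \<in> I" by (rule subsetI) auto
next
  assume "A \<in> I"
  then have "{m. \<exists>a\<in>A. int m = int a + 1} \<in> I"
    using transl unfolding translation_invariant_def by blast
  then show "Suc ` A \<in> I" by (rule subsetI) auto
qed

lemma shift_in_iff: "{n. Q (Suc n)} \<in> I \<longleftrightarrow> {n. Q n} \<in> I"
proof
  assume "{n. Q (Suc n)} \<in> I"
  \<comment> \<open>The index 0 is not a successor, so it is added back as a finite set.\<close>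
  then have "Suc ` {n. Q (Suc n)} \<union> {0} \<in> I"
    using unionI[OF _ finiteI[of "{0}"]] by (simp add: Suc_image_in_iff)
  then show "{n. Q n} \<in> I"
    by (rule subsetI) (auto simp: image_iff dest: not0_implies_Suc)
qed (use shift_in in fastforce)

section \<open>Digits and the recursion for the fractional parts\<close>

lemma digit_expansion: "c 0 = 0" "is_expansion u x c"
  using theI'[OF ex1_expansion[OF arith x]] unfolding digit_def by auto

lemma b_ge_2: "n \<ge> 1 \<Longrightarrow> b n \<ge> 2"
  using arithmetic_seq_facts(3)[OF arith, of "n - 1"] by simp

lemma b_0: "b 0 = 1"
  using arith by (simp add: ratio_def arithmetic_seq_def)

lemma b_ge_1: "b n \<ge> 1"
  using b_ge_2[of n] b_0 by (cases n) auto

lemma c_less: "int (c n) \<le> b n - 1"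
proof (cases n)
  case (Suc m)
  have "int (c n) < b n" using digit_expansion(2) Suc by (simp add: is_expansion_def)
  then show ?thesis by simp
qed (simp add: digit_expansion b_0)

lemma r_range: "0 \<le> r n" "r n < 1"
  by (simp_all add: r_def frac_lt_1)

text \<open>By \<open>expansion_partial_sum\<close> the fractional part of \<open>u k * x\<close> is
  \<open>u k\<close> times the tail of the series after \<open>k\<close> terms; passing to the next
  \<open>k\<close> multiplies by the ratio and removes one digit.\<close>

lemma r_rec: "r n = (real (c n) + r (Suc n)) / real_of_int (b n)"
proof (cases n)
  case 0
  then show ?thesis by (simp add: r_def digit_expansion b_0)
next
  case (Suc m)
  let ?s = "\<lambda>n. \<Sum>k<n. real (c (Suc k)) / real_of_int (u (Suc k))"
  have upos: "real_of_int (u k) > 0" for k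
    using arithmetic_seq_facts(1)[OF arith, of k] by linarith
  have frac_eq: "frac (real_of_int (u k) * x) = real_of_int (u k) * (x - ?s k)" for k
    using expansion_partial_sum[OF arith digit_expansion(2), of k] upos[of k]
    by (simp add: frac_def field_simps)
  have ueq: "real_of_int (u (Suc m)) = real_of_int (b (Suc m)) * real_of_int (u m)"
    by (metis arithmetic_seq_facts(2)[OF arith] of_int_mult)
  have "real (c n) + r (Suc n) = real_of_int (u (Suc m)) * (x - ?s m)"
    using frac_eq[of "Suc m"] upos[of "Suc m"] by (simp add: r_def Suc algebra_simps)
  also have "\<dots> = real_of_int (b n) * r n"
    by (simp add: ueq r_def Suc frac_eq mult.assoc)
  finally show ?thesis
    using b_ge_1[of n] by (simp add: field_simps)
qed

lemma r_mult: "real_of_int (b n) * r n = real (c n) + r (Suc n)"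
  using r_rec[of n] b_ge_1[of n] by (simp add: field_simps)

lemma real_b_ge_1: "real_of_int (b n) \<ge> 1"
  using b_ge_1[of n] by simp

lemma real_c_le: "real (c n) \<le> real_of_int (b n) - 1"
  using c_less[of n] by linarith

text \<open>With \<open>digit_ratio_ge\<close> this traps \<open>r n\<close> in an interval of
  length \<open>1 / b n\<close>, so that for large ratios the leading digit alone determines
  \<open>r n\<close> approximately.\<close>

lemma digit_ratio_le: "real (c n) / real_of_int (b n) \<le> r n"
  using r_rec[of n] r_range[of "Suc n"] real_b_ge_1[of n] by (simp add: divide_right_mono)

lemma digit_ratio_ge: "r n \<le> (real (c n) + 1) / real_of_int (b n)"
  using r_rec[of n] r_range[of "Suc n"] real_b_ge_1[of n] by (simp add: divide_right_mono)

lemma digit_succ_ratio_le_1: "(real (c n) + 1) / real_of_int (b n) \<le> 1"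
  using real_c_le[of n] real_b_ge_1[of n] by (simp add: divide_le_eq)

lemma mem_supp: "n \<in> supp u x \<longleftrightarrow> c n \<noteq> 0"
  using digit_expansion(1) by (cases n) (auto simp: supp_def)

text \<open>The fractional part of \<open>u n * x\<close> is \<open>r (Suc n)\<close>; the shift of
  the index is absorbed by translation invariance.\<close>

lemma characterized_iff:
  "to_circle x \<in> characterized_set I u \<longleftrightarrow> (\<forall>e>0. {n. e \<le> int_dist (r n)} \<in> I)"
proof -
  have "{n. e \<le> int_dist (real_of_int (u n) * x)} \<in> I \<longleftrightarrow> {n. e \<le> int_dist (r n)} \<in> I" for e
    using shift_in_iff[of "\<lambda>n. e \<le> int_dist (r n)"] by (simp add: r_def)
  then show ?thesis
    by (simp add: characterized_set_def circle_mult_to_circle ideal_converges_circle_iff[OF ideal])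
qed

section \<open>Index sets with bounded or divergent ratios\<close>

lemma b_boundedE:
  assumes "b_bounded u A"
  obtains M where "M \<ge> 1" "\<And>n. n \<in> A \<Longrightarrow> real_of_int (b n) \<le> M"
proof -
  obtain M where M: "\<And>n. n \<in> A - {0} \<Longrightarrow> \<bar>real_of_int (b n)\<bar> \<le> M"
    using assms by (auto simp: b_bounded_def bounded_iff)
  show ?thesis
  \<comment> \<open>The maximum with 1 also covers the index 0, which \<open>b_bounded\<close>
    ignores and where the ratio is 1.\<close>
  proof (rule that[of "max 1 M"])
    fix n assume "n \<in> A"
    then show "real_of_int (b n) \<le> max 1 M"
      using M[of n] b_0 by (cases "n = 0") auto
  qed simp
qed

lemma b_boundedI:
  assumes "\<And>n. n \<in> A \<Longrightarrow> b n \<le> M"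
  shows "b_bounded u A"
  unfolding b_bounded_def bounded_iff
proof (intro exI ballI)
  fix y assume "y \<in> (\<lambda>n. real_of_int (b n)) ` (A - {0})"
  then obtain n where "n \<in> A" "y = real_of_int (b n)" by blast
  with assms[of n] b_ge_1[of n] show "norm y \<le> real_of_int M" by simp
qed

lemma b_bounded_subset: "b_bounded u A \<Longrightarrow> B \<subseteq> A \<Longrightarrow> b_bounded u B"
  unfolding b_bounded_def by (erule bounded_subset) auto

text \<open>Either some level set of the ratio within \<open>A\<close> is outside the ideal, or all
  these countably many level sets lie in it, and the P-property yields one \<open>U\<close> whose
  removal leaves each of them finite.\<close>

lemma bounded_or_divergent_subset:
  assumes "A \<notin> I"
  obtains C where "C \<subseteq> A" "C \<notin> I" "b_bounded u C \<or> b_divergent u C"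
proof (cases "\<exists>M. {n \<in> A. b n \<le> int M} \<notin> I")
  case True
  then obtain M where M: "{n \<in> A. b n \<le> int M} \<notin> I" by blast
  have "b_bounded u {n \<in> A. b n \<le> int M}" by (rule b_boundedI[of _ "int M"]) simp
  with M show ?thesis by (intro that[of "{n \<in> A. b n \<le> int M}"]) auto
next
  case False
  then have "range (\<lambda>M. {n \<in> A. b n \<le> int M}) \<subseteq> I" by auto
  then obtain U where U: "U \<in> I" "\<And>M. finite ({n \<in> A. b n \<le> int M} - U)"
    using P unfolding P_ideal_def by meson
  have "b_divergent u (A - U)"
    unfolding b_divergent_def filterlim_at_top
  proof
    fix Z :: int
    show "\<forall>\<^sub>F n in along (A - U). Z \<le> b n"
      unfolding eventually_along by (rule finite_subset[OF _ U(2)[of "nat Z"]]) auto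
  qed
  with not_in_Diff[OF assms U(1)] show ?thesis by (intro that[of "A - U"]) auto
qed

lemma b_divergent_inverse:
  assumes "b_divergent u A" "e > 0"
  shows "\<forall>\<^sub>F n in along A. 1 / real_of_int (b n) < e"
proof -
  have "\<forall>\<^sub>F n in along A. \<lceil>1 / e\<rceil> + 1 \<le> b n"
    using assms(1) unfolding b_divergent_def filterlim_at_top by blast
  then show ?thesis
  proof (rule eventually_mono)
    fix n assume "\<lceil>1 / e\<rceil> + 1 \<le> b n"
    then have "1 / e < real_of_int (b n)" by linarith
    then show "1 / real_of_int (b n) < e"
      using assms(2) real_b_ge_1[of n] by (simp add: field_simps)
  qed
qed

lemma digit_ratio_r_diff: "\<bar>r n - real (c n) / real_of_int (b n)\<bar> \<le> 1 / real_of_int (b n)"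
proof -
  have "r n - real (c n) / real_of_int (b n) = r (Suc n) / real_of_int (b n)"
    by (subst r_rec) (simp add: add_divide_distrib)
  then show ?thesis
    using r_range[of "Suc n"] real_b_ge_1[of n] by (simp add: divide_right_mono)
qed

section \<open>Necessity of the conditions\<close>

context
  fixes U
  assumes U: "U \<in> I" "\<And>e. e > 0 \<Longrightarrow> finite {n. n \<notin> U \<and> e \<le> int_dist (r n)}"
begin

text \<open>\<open>U\<close> is the exceptional set provided by \<open>P_ideal_pseudo_limit\<close>;
  away from it convergence modulo the ideal is ordinary convergence.\<close>

lemma eventually_int_dist:
  assumes "e > 0" "A \<inter> U = {}"
  shows "\<forall>\<^sub>F n in along A. int_dist (r n) < e"
  unfolding eventually_along using assms(2) by (intro finite_subset[OF _ U(2)[OF assms(1)]]) auto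

text \<open>A nonzero digit with bounded ratio keeps \<open>r n\<close> away from 0, so closeness to
  an integer means closeness to 1; multiplying \<open>1 - r n\<close> by the ratio then exposes the
  digit and the next fractional part.\<close>

lemma eventually_top_digit:
  assumes "b_bounded u A" "A \<subseteq> supp u x" "A \<inter> U = {}" "0 < d" "d \<le> 1"
  shows "\<forall>\<^sub>F n in along A. int (c n) = b n - 1 \<and> 1 - d < r (Suc n)"
proof -
  obtain M where M: "M \<ge> 1" "\<And>n. n \<in> A \<Longrightarrow> real_of_int (b n) \<le> M"
    using b_boundedE[OF assms(1)] by blast
  \<comment> \<open>The tolerance \<open>d / M\<close> is at most \<open>1 / M\<close>, the lower
    bound for \<open>r n\<close>, and is still at most \<open>d\<close> after multiplication by the
    ratio.\<close>
  have e: "0 < d / M" "d / M \<le> 1 / M" "1 / M \<le> 1"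
    using M(1) assms(4,5) by (simp_all add: divide_right_mono)
  have "\<forall>\<^sub>F n in along A. n \<in> A \<and> int_dist (r n) < d / M"
    using eventually_int_dist[OF e(1) assms(3)] unfolding eventually_along
    by (rule rev_finite_subset) auto
  then show ?thesis
  proof (rule eventually_mono)
    fix n assume n: "n \<in> A \<and> int_dist (r n) < d / M"
    let ?b = "real_of_int (b n)"
    have b: "1 \<le> ?b" "?b \<le> M" using real_b_ge_1 M(2) n by auto
    have "real (c n) \<ge> 1" using n assms(2) mem_supp[of n] by auto
    then have "1 \<le> ?b * r n" using r_mult[of n] r_range[of "Suc n"] by linarith
    also have "\<dots> \<le> M * r n" using b r_range[of n] by (intro mult_right_mono) auto
    finally have "1 / M \<le> r n" using M(1) by (simp add: field_simps)
    then have "1 - d / M < r n"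
      using int_dist_lessD[of "r n" "d / M"] n r_range[of n] e by linarith
    then have "M * (1 - r n) < d" using M(1) by (simp add: field_simps)
    moreover have "?b * (1 - r n) \<le> M * (1 - r n)"
      using b r_range[of n] by (intro mult_right_mono) auto
    \<comment> \<open>The defect splits into a nonnegative integer and a nonnegative real; their sum
      is below \<open>d \<le> 1\<close>, so the integer is 0.\<close>
    moreover have "?b * (1 - r n) = (?b - 1 - real (c n)) + (1 - r (Suc n))"
      using r_mult[of n] by (simp add: algebra_simps)
    ultimately have *: "(?b - 1 - real (c n)) + (1 - r (Suc n)) < d" by linarith
    then have "1 - d < r (Suc n)" using real_c_le[of n] by linarith
    moreover have "b n - 1 - int (c n) < 1" using * r_range[of "Suc n"] assms(5) by linarith
    ultimately show "int (c n) = b n - 1 \<and> 1 - d < r (Suc n)" using c_less[of n] by linarith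
  qed
qed

text \<open>With digit 0 the recursion reads \<open>r (Suc n) = b n * r n\<close>, and this is below
  1 with \<open>b n \<ge> 2\<close>; so \<open>r n < 1 / 2\<close>, and the nearby integer is
  0.\<close>

lemma eventually_zero_digit:
  assumes "b_bounded u A" "A \<inter> supp u x = {}" "A \<inter> U = {}" "0 < d"
  shows "\<forall>\<^sub>F n in along A. r (Suc n) < d"
proof -
  obtain M where M: "M \<ge> 1" "\<And>n. n \<in> A \<Longrightarrow> real_of_int (b n) \<le> M"
    using b_boundedE[OF assms(1)] by blast
  \<comment> \<open>The cap \<open>1 / 2\<close> rules out the alternative
    \<open>1 - e < r n\<close>.\<close>
  define e where "e = min (d / M) (1 / 2)"
  have e: "0 < e" "e \<le> d / M" "e \<le> 1 / 2"
    using M(1) assms(4) min.cobounded2[of "d / M" "1 / 2"] by (auto simp: e_def simp del: min.cobounded2)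
  \<comment> \<open>The index 0 may belong to \<open>A\<close>, but its ratio is 1; it is discarded
    so that \<open>b n \<ge> 2\<close>.\<close>
  have "finite {n. n \<in> A \<and> \<not> (n \<ge> 1 \<and> int_dist (r n) < e)}"
  proof (rule finite_subset)
    show "finite ({n \<in> A. \<not> int_dist (r n) < e} \<union> {0})"
      using eventually_int_dist[OF e(1) assms(3)] by (simp add: eventually_along)
  qed auto
  then have "\<forall>\<^sub>F n in along A. n \<in> A \<and> n \<ge> 1 \<and> int_dist (r n) < e"
    unfolding eventually_along by (rule rev_finite_subset) auto
  then show ?thesis
  proof (rule eventually_mono)
    fix n assume n: "n \<in> A \<and> n \<ge> 1 \<and> int_dist (r n) < e"
    let ?b = "real_of_int (b n)"
    have b: "2 \<le> ?b" "?b \<le> M" using b_ge_2[of n] M(2) n by auto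
    have "c n = 0" using n assms(2) mem_supp[of n] by auto
    then have r: "r (Suc n) = ?b * r n" using r_mult[of n] by simp
    have "2 * r n \<le> ?b * r n" using b r_range[of n] by (intro mult_right_mono) auto
    then have "r n < 1 / 2" using r r_range[of "Suc n"] by linarith
    then have "r n < e"
      using int_dist_lessD[of "r n" e] n r_range[of n] e by linarith
    have "r (Suc n) \<le> M * r n" unfolding r using b r_range[of n] by (intro mult_right_mono) auto
    also have "\<dots> < M * (d / M)" using \<open>r n < e\<close> e M(1) by (intro mult_strict_left_mono) auto
    finally show "r (Suc n) < d" using M(1) by simp
  qed
qed

lemma top_digit_condition:
  assumes A: "b_bounded u A" "subset_mod I A (supp u x)"
  shows "subset_mod I A (supp_b u x)"
    and "subset_mod I ((\<lambda>n. n + 1) ` A) (supp u x)"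
    and "\<exists>A'. subset_upto I A' A \<and> A' \<subseteq> supp_b u x \<and>
      ((\<lambda>n. (real (c (n + 1)) + 1) / real_of_int (b (n + 1))) \<longlongrightarrow> 1) (along A')"
proof -
  define B where "B = A \<inter> supp u x - U"
  have ev: "\<forall>\<^sub>F n in along B. int (c n) = b n - 1 \<and> 1 - d < r (Suc n)" if "0 < d" "d \<le> 1" for d
    by (rule eventually_top_digit[OF b_bounded_subset[OF A(1)] _ _ that]) (auto simp: B_def)
  have AB: "A - B \<in> I"
    using unionI[OF A(2)[unfolded subset_mod_def] U(1)] by (rule subsetI) (auto simp: B_def)
  define A' where "A' = B \<inter> supp_b u x"
  \<comment> \<open>Tolerance 1 suffices, since only the equality of digits is used.\<close>
  have "B - A' \<in> I"
    by (rule finiteI, rule finite_subset[OF _ ev[unfolded eventually_along, of 1]])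
      (auto simp: A'_def B_def supp_b_def supp_def)
  then have AA': "A - A' \<in> I" using unionI[OF AB] subsetI[of "(A - B) \<union> (B - A')" "A - A'"] by blast
  then show "subset_mod I A (supp_b u x)"
    unfolding subset_mod_def by (rule subsetI) (auto simp: A'_def)
  show "subset_mod I ((\<lambda>n. n + 1) ` A) (supp u x)"
  proof -
    \<comment> \<open>A zero digit at \<open>Suc n\<close> would force
      \<open>r (Suc n) \<le> 1 / b (Suc n) \<le> 1 / 2\<close>, hence the tolerance
      \<open>1 / 2\<close>.\<close>
    have "{n \<in> B. c (Suc n) = 0} \<in> I"
    proof (rule finiteI, rule finite_subset[OF _ ev[unfolded eventually_along, of "1 / 2"]])
      show "{n \<in> B. c (Suc n) = 0} \<subseteq> {n \<in> B. \<not> (int (c n) = b n - 1 \<and> 1 - 1 / 2 < r (Suc n))}"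
      proof safe
        fix n assume n: "c (Suc n) = 0" "1 - 1 / 2 < r (Suc n)"
        have "real_of_int (b (Suc n)) \<ge> 2" using b_ge_2[of "Suc n"] by simp
        then have "1 / real_of_int (b (Suc n)) \<le> 1 / 2" by (simp add: field_simps)
        with n digit_ratio_ge[of "Suc n"] show False by simp
      qed
    qed simp_all
    then have "Suc ` ((A - B) \<union> {n \<in> B. c (Suc n) = 0}) \<in> I"
      unfolding Suc_image_in_iff by (intro unionI AB)
    then show ?thesis
      unfolding subset_mod_def by (rule subsetI) (auto simp: mem_supp)
  qed
  have "((\<lambda>n. (real (c (n + 1)) + 1) / real_of_int (b (n + 1))) \<longlongrightarrow> 1) (along A')"
  proof (rule tendstoI)
    fix d :: real assume "d > 0"
    \<comment> \<open>The ratio in the limit lies between \<open>r (Suc n)\<close> and 1, so it is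
      squeezed.\<close>
    then have "\<forall>\<^sub>F n in along A'. 1 - min d 1 < r (Suc n)"
      using eventually_along_mono[OF ev[of "min d 1"], of A']
      by (auto simp: A'_def elim: eventually_mono)
    then show "\<forall>\<^sub>F n in along A'. dist ((real (c (n + 1)) + 1) / real_of_int (b (n + 1))) 1 < d"
    proof (rule eventually_mono)
      fix n assume "1 - min d 1 < r (Suc n)"
      with digit_ratio_ge[of "Suc n"] digit_succ_ratio_le_1[of "Suc n"]
      show "dist ((real (c (n + 1)) + 1) / real_of_int (b (n + 1))) 1 < d"
        unfolding dist_real_def Suc_eq_plus1 by linarith
    qed
  qed
  with AA' show "\<exists>A'. subset_upto I A' A \<and> A' \<subseteq> supp_b u x \<and>
      ((\<lambda>n. (real (c (n + 1)) + 1) / real_of_int (b (n + 1))) \<longlongrightarrow> 1) (along A')"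
    by (intro exI[of _ A']) (auto simp: subset_upto_def A'_def B_def)
qed

lemma zero_digit_condition:
  assumes A: "b_bounded u A" "A \<inter> supp u x \<in> I"
  shows "\<exists>B'. subset_upto I B' A \<and>
      ((\<lambda>n. real (c (n + 1)) / real_of_int (b (n + 1))) \<longlongrightarrow> 0) (along B')"
proof (intro exI conjI)
  let ?B = "A - supp u x - U"
  show "subset_upto I ?B A"
    unfolding subset_upto_def using unionI[OF A(2) U(1)] by (auto intro: subsetI)
  show "((\<lambda>n. real (c (n + 1)) / real_of_int (b (n + 1))) \<longlongrightarrow> 0) (along ?B)"
  proof (rule tendstoI)
    fix d :: real assume "d > 0"
    then have "\<forall>\<^sub>F n in along ?B. r (Suc n) < d"
      by (intro eventually_zero_digit b_bounded_subset[OF A(1)]) auto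
    then show "\<forall>\<^sub>F n in along ?B. dist (real (c (n + 1)) / real_of_int (b (n + 1))) 0 < d"
    proof (rule eventually_mono)
      fix n assume "r (Suc n) < d"
      with digit_ratio_le[of "Suc n"] real_b_ge_1[of "Suc n"]
      show "dist (real (c (n + 1)) / real_of_int (b (n + 1))) 0 < d" by simp
    qed
  qed
qed

text \<open>The digit ratio differs from \<open>r n\<close> by at most \<open>1 / b n\<close>, which
  tends to 0 along \<open>A\<close>.\<close>

lemma divergent_condition:
  assumes A: "b_divergent u A"
  shows "\<exists>B. subset_upto I B A \<and> ((\<lambda>n. to_circle (real (c n) / real_of_int (b n))) \<longlongrightarrow> 0) (along B)"
proof (intro exI conjI)
  show "subset_upto I (A - U) A"
    unfolding subset_upto_def using U(1) by (auto intro: subsetI)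
  show "((\<lambda>n. to_circle (real (c n) / real_of_int (b n))) \<longlongrightarrow> 0) (along (A - U))"
    unfolding tendsto_circle_zero_iff
  proof (intro allI impI)
    fix e :: real assume e: "e > 0"
    then have "\<forall>\<^sub>F n in along (A - U). int_dist (r n) < e / 2"
      by (intro eventually_int_dist) auto
    moreover have "\<forall>\<^sub>F n in along (A - U). 1 / real_of_int (b n) < e / 2"
      by (rule eventually_along_mono[OF b_divergent_inverse[OF A]]) (use e in auto)
    ultimately show "\<forall>\<^sub>F n in along (A - U). int_dist (real (c n) / real_of_int (b n)) < e"
    proof eventually_elim
      case (elim n)
      then show ?case
        using int_dist_add_le[of "r n" "real (c n) / real_of_int (b n) - r n"] digit_ratio_r_diff[of n]
        by simp
    qed
  qed
qed

end

section \<open>Sufficiency of the conditions\<close>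

lemma eventually_along_subset:
  assumes "A \<notin> I" "eventually Q (along A)"
  shows "{n \<in> A. Q n} \<notin> I"
proof -
  have "{n \<in> A. \<not> Q n} \<in> I" using assms(2) finiteI by (simp add: eventually_along)
  from not_in_Diff[OF assms(1) this] show ?thesis
    by (simp add: set_diff_eq conj_disj_distribL cong: conj_cong)
qed

text \<open>The limits in (a) evaluate digits at the successor of \<open>n\<close>; this reindexes
  them by that successor.\<close>

lemma eventually_along_shift:
  assumes "eventually Q (along A)" "C \<subseteq> Suc ` A"
  shows "\<forall>\<^sub>F n in along C. Q (n - 1)"
proof -
  have "finite (Suc ` {n \<in> A. \<not> Q n})" using assms(1) by (simp add: eventually_along)
  then show ?thesis unfolding eventually_along by (rule rev_finite_subset) (use assms(2) in auto)
qed

lemma predecessors_not_in: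
  assumes "C \<subseteq> Suc ` A" "C \<notin> I"
  shows "{n \<in> A. Suc n \<in> C} \<notin> I"
proof -
  have "Suc ` {n \<in> A. Suc n \<in> C} = C" using assms(1) by auto
  with assms(2) show ?thesis by (metis Suc_image_in_iff)
qed

text \<open>At a top digit \<open>1 - r n\<close> equals \<open>(1 - r (Suc n)) / b n\<close>, so
  going back one index halves the distance to 1. The induction ranges over all \<open>A\<close>, as
  it is applied to a subset of the shifted set.\<close>

lemma top_digits_accumulate:
  assumes cond: "\<And>A. A \<notin> I \<Longrightarrow> b_bounded u A \<Longrightarrow> subset_mod I A (supp u x) \<Longrightarrow>
      subset_mod I ((\<lambda>n. n + 1) ` A) (supp u x) \<and>
      (\<exists>A'. subset_upto I A' A \<and> A' \<subseteq> supp_b u x \<and>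
        ((\<lambda>n. (real (c (n + 1)) + 1) / real_of_int (b (n + 1))) \<longlongrightarrow> 1) (along A'))"
  shows "A \<notin> I \<Longrightarrow> b_bounded u A \<Longrightarrow> A \<subseteq> supp u x \<Longrightarrow> {n \<in> A. 1 - 1 / 2 ^ k \<le> r n} \<notin> I"
proof (induction k arbitrary: A)
  case 0
  then show ?case using r_range by simp
next
  case (Suc k)
  then have "subset_mod I A (supp u x)"
    using finiteI by (simp add: subset_mod_def Diff_eq_empty_iff[THEN iffD2])
  then obtain A' where A': "subset_upto I A' A" "A' \<subseteq> supp_b u x"
      "((\<lambda>n. (real (c (n + 1)) + 1) / real_of_int (b (n + 1))) \<longlongrightarrow> 1) (along A')"
    and sub: "Suc ` A - supp u x \<in> I"
    using cond[OF Suc.prems(1,2)] by (auto simp: subset_mod_def)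
  have A'I: "A' \<notin> I" using subset_upto_not_in[OF A'(1) Suc.prems(1)] .
  have A'A: "A' \<subseteq> A" using A'(1) by (simp add: subset_upto_def)
  have "Suc ` A' \<notin> I" using A'I by (simp add: Suc_image_in_iff)
  \<comment> \<open>Discarding the shifted points outside the support gives the exact inclusion that
    the induction hypothesis requires.\<close>
  then have "Suc ` A' - (Suc ` A - supp u x) \<notin> I" using not_in_Diff sub by blast
  then obtain C where C: "C \<subseteq> Suc ` A' - (Suc ` A - supp u x)" "C \<notin> I"
      "b_bounded u C \<or> b_divergent u C"
    using bounded_or_divergent_subset by blast
  have "{m \<in> C. 1 - 1 / 2 ^ k \<le> r m} \<notin> I"
    using C(3)
  proof
    assume "b_bounded u C"
    then show ?thesis using C(1,2) A'A by (intro Suc.IH) auto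
  next
    assume div: "b_divergent u C"
    \<comment> \<open>Half of \<open>1 / 2 ^ k\<close>: one half for the limit, one for the
      \<open>1 / b n\<close> lost in passing from \<open>c n + 1\<close> to
      \<open>c n\<close>.\<close>
    let ?e = "1 / 2 ^ Suc k :: real"
    have "\<forall>\<^sub>F n in along A'. 1 - ?e < (real (c (n + 1)) + 1) / real_of_int (b (n + 1))"
      using A'(3) by (rule order_tendstoD) simp
    from eventually_along_shift[OF this, of C]
    have "\<forall>\<^sub>F n in along C. 1 - ?e < (real (c (n - 1 + 1)) + 1) / real_of_int (b (n - 1 + 1))"
      using C(1) by auto
    moreover have "\<forall>\<^sub>F n in along C. 1 / real_of_int (b n) < ?e"
      by (rule b_divergent_inverse[OF div]) simp
    \<comment> \<open>At 0 truncated subtraction would make \<open>n - 1 + 1\<close> equal to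
      1.\<close>
    moreover have "\<forall>\<^sub>F n in along C. n \<ge> 1"
      unfolding eventually_along by (rule finite_subset[of _ "{0}"]) auto
    ultimately have "\<forall>\<^sub>F n in along C. 1 - 1 / 2 ^ k \<le> r n"
    proof eventually_elim
      case (elim n)
      then show ?case using digit_ratio_le[of n] by (simp add: add_divide_distrib)
    qed
    then show ?thesis by (rule eventually_along_subset[OF C(2)])
  qed
  then have "{n \<in> A'. Suc n \<in> {m \<in> C. 1 - 1 / 2 ^ k \<le> r m}} \<notin> I"
    using C(1) by (intro predecessors_not_in) auto
  moreover have "{n \<in> A'. Suc n \<in> {m \<in> C. 1 - 1 / 2 ^ k \<le> r m}} \<subseteq> {n \<in> A. 1 - 1 / 2 ^ Suc k \<le> r n}"
  proof safe
    fix n assume n: "n \<in> A'" "1 - 1 / 2 ^ k \<le> r (Suc n)"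
    then have "n \<ge> 1" "int (c n) = b n - 1" using A'(2) by (auto simp: supp_b_def)
    then have b: "real_of_int (b n) \<ge> 2" and "real (c n) = real_of_int (b n) - 1"
      using b_ge_2[of n] by linarith+
    then have *: "real_of_int (b n) * (1 - r n) = 1 - r (Suc n)"
      using r_mult[of n] by (simp add: algebra_simps)
    have "2 * (1 - r n) \<le> real_of_int (b n) * (1 - r n)"
      using b r_range[of n] by (intro mult_right_mono) auto
    then have "2 * (1 - r n) \<le> 1 / 2 ^ k" using * n(2) by linarith
    then show "1 - 1 / 2 ^ Suc k \<le> r n" by (simp add: field_simps)
  qed (use A'A in auto)
  ultimately show ?case by (rule not_in_mono)
qed

text \<open>Mirror image at 0. Here (a2) says nothing about the support at the next index; in the
  bounded case the vanishing of the digit there comes from the limit.\<close>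

lemma zero_digits_accumulate:
  assumes cond: "\<And>A. A \<notin> I \<Longrightarrow> b_bounded u A \<Longrightarrow> A \<inter> supp u x \<in> I \<Longrightarrow>
      \<exists>B'. subset_upto I B' A \<and>
        ((\<lambda>n. real (c (n + 1)) / real_of_int (b (n + 1))) \<longlongrightarrow> 0) (along B')"
  shows "A \<notin> I \<Longrightarrow> b_bounded u A \<Longrightarrow> A \<inter> supp u x = {} \<Longrightarrow> {n \<in> A. r n \<le> 1 / 2 ^ k} \<notin> I"
proof (induction k arbitrary: A)
  case 0
  then show ?case using r_range by (simp add: less_imp_le)
next
  case (Suc k)
  then obtain A0 where A0: "subset_upto I A0 A"
      "((\<lambda>n. real (c (n + 1)) / real_of_int (b (n + 1))) \<longlongrightarrow> 0) (along A0)"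
    using cond[OF Suc.prems(1,2)] finiteI by auto
  \<comment> \<open>Halving needs a ratio of at least 2, which fails at the index 0.\<close>
  define A' where "A' = A0 - {0}"
  have A'I: "A' \<notin> I"
    unfolding A'_def using subset_upto_not_in[OF A0(1) Suc.prems(1)] by (intro not_in_Diff finiteI) auto
  have A'A: "A' \<subseteq> A" using A0(1) by (auto simp: subset_upto_def A'_def)
  have small: "\<forall>\<^sub>F n in along C. real (c n) / real_of_int (b n) < e"
    if "e > 0" "C \<subseteq> Suc ` A'" for C e
  proof -
    have "\<forall>\<^sub>F n in along A0. real (c (n + 1)) / real_of_int (b (n + 1)) < e"
      using A0(2) that(1) by (rule order_tendstoD)
    from eventually_along_shift[OF this, of C]
    have "\<forall>\<^sub>F n in along C. real (c (n - 1 + 1)) / real_of_int (b (n - 1 + 1)) < e"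
      using that(2) by (auto simp: A'_def)
    moreover have "\<forall>\<^sub>F n in along C. n \<ge> 1"
      unfolding eventually_along by (rule finite_subset[of _ "{0}"]) auto
    ultimately show ?thesis by eventually_elim simp
  qed
  have "Suc ` A' \<notin> I" using A'I by (simp add: Suc_image_in_iff)
  then obtain C where C: "C \<subseteq> Suc ` A'" "C \<notin> I" "b_bounded u C \<or> b_divergent u C"
    using bounded_or_divergent_subset by blast
  have "{m \<in> C. r m \<le> 1 / 2 ^ k} \<notin> I"
    using C(3)
  proof
    assume bdd: "b_bounded u C"
    then obtain M where M: "M \<ge> 1" "\<And>n. n \<in> C \<Longrightarrow> real_of_int (b n) \<le> M"
      using b_boundedE by blast
    \<comment> \<open>A nonzero digit has ratio at least \<open>1 / M\<close> when
      \<open>b n \<le> M\<close>, so below this threshold the digit is 0.\<close>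
    have "{n \<in> C. real (c n) / real_of_int (b n) < 1 / M} \<notin> I"
      using M(1) by (intro eventually_along_subset[OF C(2)] small[OF _ C(1)]) auto
    moreover have "{n \<in> C. real (c n) / real_of_int (b n) < 1 / M} \<subseteq> C - supp u x"
    proof safe
      fix n assume n: "n \<in> C" "real (c n) / real_of_int (b n) < 1 / M" "n \<in> supp u x"
      then have "1 \<le> real (c n)" by (simp add: mem_supp)
      then have "1 / M \<le> real (c n) / real_of_int (b n)"
        using M(2)[OF n(1)] real_b_ge_1[of n] by (intro frac_le) auto
      with n(2) show False by linarith
    qed
    ultimately have "C - supp u x \<notin> I" by (rule not_in_mono)
    then have "{n \<in> C - supp u x. r n \<le> 1 / 2 ^ k} \<notin> I"
      using b_bounded_subset[OF bdd] by (intro Suc.IH) auto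
    then show ?thesis by (rule not_in_mono) auto
  next
    assume div: "b_divergent u C"
    let ?e = "1 / 2 ^ Suc k :: real"
    have "\<forall>\<^sub>F n in along C. real (c n) / real_of_int (b n) < ?e"
      by (rule small[OF _ C(1)]) simp
    moreover have "\<forall>\<^sub>F n in along C. 1 / real_of_int (b n) < ?e"
      by (rule b_divergent_inverse[OF div]) simp
    ultimately have "\<forall>\<^sub>F n in along C. r n \<le> 1 / 2 ^ k"
    proof eventually_elim
      case (elim n)
      then show ?case using digit_ratio_ge[of n] by (simp add: add_divide_distrib)
    qed
    then show ?thesis by (rule eventually_along_subset[OF C(2)])
  qed
  then have "{n \<in> A'. Suc n \<in> {m \<in> C. r m \<le> 1 / 2 ^ k}} \<notin> I"
    using C(1) by (intro predecessors_not_in) auto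
  moreover have "{n \<in> A'. Suc n \<in> {m \<in> C. r m \<le> 1 / 2 ^ k}} \<subseteq> {n \<in> A. r n \<le> 1 / 2 ^ Suc k}"
  proof safe
    fix n assume n: "n \<in> A'" "r (Suc n) \<le> 1 / 2 ^ k"
    then have "n \<ge> 1" "c n = 0" using A'A Suc.prems(3) mem_supp[of n] by (auto simp: A'_def)
    then have b: "real_of_int (b n) \<ge> 2" and *: "real_of_int (b n) * r n = r (Suc n)"
      using b_ge_2[of n] r_mult[of n] by auto
    have "2 * r n \<le> real_of_int (b n) * r n"
      using b r_range[of n] by (intro mult_right_mono) auto
    then have "2 * r n \<le> 1 / 2 ^ k" using * n(2) by linarith
    then show "r n \<le> 1 / 2 ^ Suc k" by (simp add: field_simps)
  qed (use A'A in auto)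
  ultimately show ?case by (rule not_in_mono)
qed

lemma int_dist_r_small:
  assumes top: "\<And>A. A \<notin> I \<Longrightarrow> b_bounded u A \<Longrightarrow> subset_mod I A (supp u x) \<Longrightarrow>
      subset_mod I ((\<lambda>n. n + 1) ` A) (supp u x) \<and>
      (\<exists>A'. subset_upto I A' A \<and> A' \<subseteq> supp_b u x \<and>
        ((\<lambda>n. (real (c (n + 1)) + 1) / real_of_int (b (n + 1))) \<longlongrightarrow> 1) (along A'))"
    and zero: "\<And>A. A \<notin> I \<Longrightarrow> b_bounded u A \<Longrightarrow> A \<inter> supp u x \<in> I \<Longrightarrow>
      \<exists>B'. subset_upto I B' A \<and>
        ((\<lambda>n. real (c (n + 1)) / real_of_int (b (n + 1))) \<longlongrightarrow> 0) (along B')"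
    and divergent: "\<And>A. A \<notin> I \<Longrightarrow> b_divergent u A \<Longrightarrow>
      \<exists>B. subset_upto I B A \<and> ((\<lambda>n. to_circle (real (c n) / real_of_int (b n))) \<longlongrightarrow> 0) (along B)"
    and e: "e > 0"
  shows "{n. e \<le> int_dist (r n)} \<in> I"
proof (rule ccontr)
  assume "{n. e \<le> int_dist (r n)} \<notin> I"
  then obtain A where A: "A \<subseteq> {n. e \<le> int_dist (r n)}" "A \<notin> I" "b_bounded u A \<or> b_divergent u A"
    using bounded_or_divergent_subset by blast
  \<comment> \<open>For this \<open>k\<close> all \<open>r n\<close> with \<open>n\<close> in
    \<open>A\<close> are farther than \<open>1 / 2 ^ k\<close> from 0 and 1, so the sets that
    accumulate by the two preceding lemmas would be empty.\<close>
  obtain k where k: "1 / 2 ^ k < e"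
    using real_arch_pow_inv[OF e, of "1 / 2"] by (auto simp: power_one_over)
  have far: "1 / 2 ^ k < r n" "r n < 1 - 1 / 2 ^ k" if "n \<in> A" for n
  proof -
    have "e \<le> int_dist (r n)" using A(1) that by blast
    moreover have "int_dist (r n) \<le> r n" using int_dist_le[of "r n" 0] r_range[of n] by simp
    moreover have "int_dist (r n) \<le> 1 - r n" using int_dist_le[of "r n" 1] r_range[of n] by simp
    ultimately show "1 / 2 ^ k < r n" "r n < 1 - 1 / 2 ^ k" using k by linarith+
  qed
  from A(3) show False
  proof
    assume bdd: "b_bounded u A"
    \<comment> \<open>\<open>A\<close> may meet both the support and its complement; one of the two
      parts is outside the ideal.\<close>
    have "A \<inter> supp u x \<union> (A - supp u x) \<notin> I" using A(2) by (simp add: Int_Diff_Un)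
    then consider "A \<inter> supp u x \<notin> I" | "A - supp u x \<notin> I" using unionI by blast
    then show False
    proof cases
      case 1
      then have "{n \<in> A \<inter> supp u x. 1 - 1 / 2 ^ k \<le> r n} \<notin> I"
        using b_bounded_subset[OF bdd] by (intro top_digits_accumulate top) auto
      moreover have "{n \<in> A \<inter> supp u x. 1 - 1 / 2 ^ k \<le> r n} = {}" using far by fastforce
      ultimately show False using finiteI by (metis finite.emptyI)
    next
      case 2
      then have "{n \<in> A - supp u x. r n \<le> 1 / 2 ^ k} \<notin> I"
        using b_bounded_subset[OF bdd] by (intro zero_digits_accumulate zero) auto
      moreover have "{n \<in> A - supp u x. r n \<le> 1 / 2 ^ k} = {}" using far by fastforce
      ultimately show False using finiteI by (metis finite.emptyI)
    qed
  next
    assume div: "b_divergent u A"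
    obtain B where B: "subset_upto I B A"
        "((\<lambda>n. to_circle (real (c n) / real_of_int (b n))) \<longlongrightarrow> 0) (along B)"
      using divergent[OF A(2) div] by blast
    have BA: "B \<subseteq> A" using B(1) by (simp add: subset_upto_def)
    have "\<forall>\<^sub>F n in along B. int_dist (real (c n) / real_of_int (b n)) < e / 2"
      using B(2) half_gt_zero[OF e] unfolding tendsto_circle_zero_iff by blast
    moreover have "\<forall>\<^sub>F n in along B. 1 / real_of_int (b n) < e / 2"
      by (rule eventually_along_mono[OF b_divergent_inverse[OF div] BA]) (use e in simp)
    ultimately have "\<forall>\<^sub>F n in along B. int_dist (r n) < e"
    proof eventually_elim
      case (elim n)
      then show ?case
        using int_dist_add_le[of "real (c n) / real_of_int (b n)" "r n - real (c n) / real_of_int (b n)"]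
          digit_ratio_r_diff[of n] by simp
    qed
    then have "{n \<in> B. int_dist (r n) < e} \<notin> I"
      by (rule eventually_along_subset[OF subset_upto_not_in[OF B(1) A(2)]])
    moreover have "{n \<in> B. int_dist (r n) < e} = {}" using BA A(1) by fastforce
    ultimately show False using finiteI by (metis finite.emptyI)
  qed
qed

end

theorem theorem1p10:
  fixes u :: "nat \<Rightarrow> int" and I :: "nat set set" and x :: real
  assumes "arithmetic_seq u"
    and "set_ideal I" and "translation_invariant I" and "free_ideal I" and "P_ideal I"
    and "x \<in> {0..<1}"
  shows "to_circle x \<in> characterized_set I u \<longleftrightarrow>
    (\<forall>A. A \<notin> I \<longrightarrow>
      (b_bounded u A \<longrightarrow>
        (subset_mod I A (supp u x) \<longrightarrow>
           subset_mod I A (supp_b u x) \<and>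
           subset_mod I ((\<lambda>n. n + 1) ` A) (supp u x) \<and>
           (\<exists>A'. subset_upto I A' A \<and> A' \<subseteq> supp_b u x \<and>
             ((\<lambda>n. (real (digit u x (n + 1)) + 1) / real_of_int (ratio u (n + 1))) \<longlongrightarrow> 1)
               (along A'))) \<and>
        (A \<inter> supp u x \<in> I \<longrightarrow>
           (\<exists>B'. subset_upto I B' A \<and>
             ((\<lambda>n. real (digit u x (n + 1)) / real_of_int (ratio u (n + 1))) \<longlongrightarrow> 0)
               (along B')))) \<and>
      (b_divergent u A \<longrightarrow>
        (\<exists>B. subset_upto I B A \<and>
          ((\<lambda>n. to_circle (real (digit u x n) / real_of_int (ratio u n))) \<longlongrightarrow> 0) (along B))))"
    (is "_ \<longleftrightarrow> ?conds")
proof -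
  have "0 \<le> x" "x < 1" using assms(6) by auto
  note hyps = assms(1-5) this
  let ?r = "rescaled_frac u x"
  show ?thesis
  proof
    assume "to_circle x \<in> characterized_set I u"
    \<comment> \<open>One exceptional set, chosen before \<open>A\<close>, serves all three
      conditions.\<close>
    then have "\<exists>U\<in>I. \<forall>e>0. finite {n. n \<notin> U \<and> e \<le> int_dist (?r n)}"
      by (intro P_ideal_pseudo_limit[OF assms(5)]) (simp add: characterized_iff[OF hyps])
    then obtain U where U: "U \<in> I" "\<And>e. e > 0 \<Longrightarrow> finite {n. n \<notin> U \<and> e \<le> int_dist (?r n)}"
      by blast
    show ?conds
      using top_digit_condition[OF hyps U] zero_digit_condition[OF hyps U] divergent_condition[OF hyps U] by blast
  next
    assume conds: ?conds
    have "{n. e \<le> int_dist (?r n)} \<in> I" if "e > 0" for e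
      by (rule int_dist_r_small[OF hyps _ _ _ that]) (use conds in blast)+
    then show "to_circle x \<in> characterized_set I u"
      by (simp add: characterized_iff[OF hyps])
  qed
qed

end
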